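(* Let $k$ be a field of characteristic zero, let $p\geq 1$ be an integer, and let $[T_0^p]$ be the differential ideal of $k\{T\}$ generated by $T_0^p$. For every integer $i\geq 0$, the least positive integer $q$ such that $T_i^{q}\in [T_0^p]$ (that is, the nilpotency index of the image of $T_i$ in $k\{T\}/[T_0^p]$) equals $(i+1)p-i$.
   Context: $k\{T\}$ denotes the polynomial $k$-algebra $k[T_i;\ i\in\mathbb{Z}_{\geq 0}]$ in countably many variables endowed with the $k$-linear derivation $\partial$ defined by $\partial T_i=T_{i+1}$ for all $i\geq 0$. The differential ideal generated by an element $f$ is the smallest ideal containing $f$ and stable under $\partial$, i.e. the ideal generated by $\partial^n(f)$, $n\geq 0$. *)

theory Defs
  imports Complex_Main "HOL-Library.Poly_Mapping"
begin

text \<open>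
  Monomials in the variables \<open>T\<^sub>i\<close> are finitely supported exponent vectors, and the
  multiplication of \<^typ>\<open>(nat \<Rightarrow>\<^sub>0 nat) \<Rightarrow>\<^sub>0 'k\<close> is convolution, so this type is the
  polynomial ring \<open>k[T\<^sub>i; i \<ge> 0]\<close>.
\<close>

type_synonym 'k dpoly = "(nat \<Rightarrow>\<^sub>0 nat) \<Rightarrow>\<^sub>0 'k"

abbreviation Const :: "'k::field_char_0 \<Rightarrow> 'k dpoly" where
  "Const c \<equiv> Poly_Mapping.single 0 c"

definition T :: "nat \<Rightarrow> 'k::field_char_0 dpoly" where
  "T i = Poly_Mapping.single (Poly_Mapping.single i 1) 1"

text \<open>
  The derivation is \<open>\<partial> f = (\<Sum>i. (\<partial>f / \<partial>T\<^sub>i) * T\<^sub>i\<^sub>+\<^sub>1)\<close>, spelled out on monomials.  It is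
  characterised by lemmas \<open>derivation_deriv\<close>, \<open>deriv_T\<close> and \<open>derivation_unique\<close> below.
\<close>

definition deriv :: "'k::field_char_0 dpoly \<Rightarrow> 'k dpoly" where
  "deriv f = (\<Sum>m \<in> Poly_Mapping.keys f. \<Sum>i \<in> Poly_Mapping.keys m.
     Poly_Mapping.single (m - Poly_Mapping.single i 1 + Poly_Mapping.single (Suc i) 1)
       (of_nat (Poly_Mapping.lookup m i) * Poly_Mapping.lookup f m))"

definition k_derivation :: "('k::field_char_0 dpoly \<Rightarrow> 'k dpoly) \<Rightarrow> bool" where
  "k_derivation D \<longleftrightarrow>
     (\<forall>f g. D (f + g) = D f + D g) \<and>
     (\<forall>c f. D (Const c * f) = Const c * D f) \<and>
     (\<forall>f g. D (f * g) = D f * g + f * D g)"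

text \<open>
  Ideals of a commutative ring are its submodules as a module over itself.
\<close>

definition differential_ideal :: "'k::field_char_0 dpoly set \<Rightarrow> bool" where
  "differential_ideal I \<longleftrightarrow> module.subspace (*) I \<and> (\<forall>f \<in> I. deriv f \<in> I)"

definition diff_ideal_gen :: "'k::field_char_0 dpoly \<Rightarrow> 'k dpoly set" where
  "diff_ideal_gen f = \<Inter> {I. differential_ideal I \<and> f \<in> I}"


lemma module_self: "module ((*) :: 'a::comm_ring_1 \<Rightarrow> 'a \<Rightarrow> 'a)"
  by unfold_locales (simp_all add: algebra_simps)

lemma ideal_iff:
  "module.subspace (*) (I :: 'a::comm_ring_1 set) \<longleftrightarrow>
     0 \<in> I \<and> (\<forall>x\<in>I. \<forall>y\<in>I. x + y \<in> I) \<and> (\<forall>a. \<forall>x\<in>I. a * x \<in> I)"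
  unfolding module.subspace_def[OF module_self] by auto

definition deriv_monom :: "(nat \<Rightarrow>\<^sub>0 nat) \<Rightarrow> 'k::field_char_0 \<Rightarrow> 'k dpoly" where
  "deriv_monom m c = (\<Sum>i \<in> Poly_Mapping.keys m.
     Poly_Mapping.single (m - Poly_Mapping.single i 1 + Poly_Mapping.single (Suc i) 1)
       (of_nat (Poly_Mapping.lookup m i) * c))"

lemma deriv_monom_add: "deriv_monom m (a + b) = deriv_monom m a + deriv_monom m b"
  by (simp add: deriv_monom_def distrib_left single_add sum.distrib)

lemma deriv_monom_0 [simp]: "deriv_monom m 0 = 0"
  by (simp add: deriv_monom_def)

lemma deriv_monom_superset:
  assumes "finite S" "Poly_Mapping.keys m \<subseteq> S"
  shows "deriv_monom m c = (\<Sum>i \<in> S.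
     Poly_Mapping.single (m - Poly_Mapping.single i 1 + Poly_Mapping.single (Suc i) 1)
       (of_nat (Poly_Mapping.lookup m i) * c))"
  unfolding deriv_monom_def
  by (rule sum.mono_neutral_left) (use assms in \<open>auto simp: in_keys_iff\<close>)

lemma deriv_superset:
  assumes "finite S" "Poly_Mapping.keys f \<subseteq> S"
  shows "deriv f = (\<Sum>m \<in> S. deriv_monom m (Poly_Mapping.lookup f m))"
  unfolding deriv_def deriv_monom_def[symmetric]
  by (rule sum.mono_neutral_left) (use assms in \<open>auto simp: in_keys_iff\<close>)

lemma deriv_single: "deriv (Poly_Mapping.single m c) = deriv_monom m c"
  by (subst deriv_superset[of "{m}"]) auto

lemma deriv_add: "deriv (f + g) = deriv f + deriv g"
proof -
  let ?S = "Poly_Mapping.keys f \<union> Poly_Mapping.keys g"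
  have "deriv (f + g) = (\<Sum>m \<in> ?S. deriv_monom m (Poly_Mapping.lookup (f + g) m))"
    by (rule deriv_superset) (use keys_add[of f g] in auto)
  also have "\<dots> = (\<Sum>m \<in> ?S. deriv_monom m (Poly_Mapping.lookup f m)) +
                  (\<Sum>m \<in> ?S. deriv_monom m (Poly_Mapping.lookup g m))"
    by (simp add: lookup_add deriv_monom_add sum.distrib)
  also have "\<dots> = deriv f + deriv g"
    by (subst (1 2) deriv_superset[of ?S]) auto
  finally show ?thesis .
qed

lemma dpoly_induct [case_names zero single add]:
  fixes f :: "'a \<Rightarrow>\<^sub>0 'b::comm_monoid_add"
  assumes "P 0" "\<And>m c. P (Poly_Mapping.single m c)" "\<And>f g. P f \<Longrightarrow> P g \<Longrightarrow> P (f + g)"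
  shows "P f"
proof (induction f rule: update_induct)
  case const
  show ?case by (rule assms(1))
next
  case (update f a b)
  have "Poly_Mapping.update a b f = f + Poly_Mapping.single a b"
    using update(1)
    by (intro poly_mapping_eqI) (auto simp: lookup_update lookup_add lookup_single in_keys_iff when_def)
  then show ?case using assms update by metis
qed

lemma monom_shift:
  fixes m n e e' :: "nat \<Rightarrow>\<^sub>0 nat"
  assumes "Poly_Mapping.lookup m i \<noteq> 0"
  shows "m + n - Poly_Mapping.single i 1 + e = (m - Poly_Mapping.single i 1 + e) + n"
  by (rule poly_mapping_eqI) (use assms in \<open>auto simp: lookup_add lookup_minus lookup_single when_def\<close>)

lemma keys_add_nat:
  fixes m n :: "nat \<Rightarrow>\<^sub>0 nat"
  shows "Poly_Mapping.keys (m + n) = Poly_Mapping.keys m \<union> Poly_Mapping.keys n"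
  by (auto simp: in_keys_iff lookup_add)

lemma deriv_monom_mult:
  "deriv_monom (m + n) (a * b) =
     deriv_monom m a * Poly_Mapping.single n b + Poly_Mapping.single m a * deriv_monom n b"
proof -
  let ?S = "Poly_Mapping.keys m \<union> Poly_Mapping.keys n"
  let ?e = "\<lambda>i. Poly_Mapping.single i (1::nat)"
  have "deriv_monom (m + n) (a * b) = (\<Sum>i\<in>?S.
      Poly_Mapping.single (m - ?e i + ?e (Suc i)) (of_nat (Poly_Mapping.lookup m i) * a) * Poly_Mapping.single n b +
      Poly_Mapping.single m a * Poly_Mapping.single (n - ?e i + ?e (Suc i)) (of_nat (Poly_Mapping.lookup n i) * b))"
    unfolding deriv_monom_def keys_add_nat
  proof (rule sum.cong[OF refl], goal_cases)
    case (1 i)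
    have A: "Poly_Mapping.single (m + n - ?e i + ?e (Suc i)) (of_nat (Poly_Mapping.lookup m i) * (a * b)) =
        Poly_Mapping.single (m - ?e i + ?e (Suc i)) (of_nat (Poly_Mapping.lookup m i) * a) * Poly_Mapping.single n b"
    proof (cases "Poly_Mapping.lookup m i = 0")
      case False
      show ?thesis unfolding monom_shift[OF False] mult_single mult.assoc ..
    qed simp
    have B: "Poly_Mapping.single (m + n - ?e i + ?e (Suc i)) (of_nat (Poly_Mapping.lookup n i) * (a * b)) =
        Poly_Mapping.single m a * Poly_Mapping.single (n - ?e i + ?e (Suc i)) (of_nat (Poly_Mapping.lookup n i) * b)"
    proof (cases "Poly_Mapping.lookup n i = 0")
      case False
      have "m + n - ?e i + ?e (Suc i) = m + (n - ?e i + ?e (Suc i))"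
        using monom_shift[OF False, of m "?e (Suc i)"] by (simp only: add.commute)
      then show ?thesis by (simp only: mult_single mult.left_commute)
    qed simp
    show ?case
      unfolding A[symmetric] B[symmetric] single_add[symmetric]
      by (simp add: lookup_add distrib_right)
  qed
  also have "\<dots> = deriv_monom m a * Poly_Mapping.single n b + Poly_Mapping.single m a * deriv_monom n b"
    by (simp add: deriv_monom_superset[of ?S] sum.distrib sum_distrib_left sum_distrib_right)
  finally show ?thesis .
qed

lemma deriv_0 [simp]: "deriv 0 = 0"
  by (simp add: deriv_def)

lemma deriv_mult: "deriv (f * g) = deriv f * g + f * deriv g"
proof (induction f rule: dpoly_induct)
  case (single m a)
  show ?case
    by (induction g rule: dpoly_induct)
      (simp_all add: deriv_add mult_single deriv_single deriv_monom_mult algebra_simps)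
qed (simp_all add: deriv_add algebra_simps)

lemma deriv_Const: "deriv (Const c) = 0"
  by (simp add: deriv_single deriv_monom_def)

lemma derivation_deriv: "k_derivation deriv"
  by (simp add: k_derivation_def deriv_add deriv_mult deriv_Const)

lemma deriv_T: "deriv (T i) = T (Suc i)"
  by (simp add: T_def deriv_single deriv_monom_def)

lemma single_monom_induct [case_names Const mult]:
  fixes m :: "nat \<Rightarrow>\<^sub>0 nat"
  assumes "\<And>c. P (Const c)" "\<And>f i. P f \<Longrightarrow> P (T i * f)"
  shows "P (Poly_Mapping.single m c)"
proof (induction m rule: dpoly_induct)
  case zero
  show ?case by (rule assms(1))
next
  have *: "P (Poly_Mapping.single (Poly_Mapping.single i n + m) c)"
    if "P (Poly_Mapping.single m c)" for i n and m :: "nat \<Rightarrow>\<^sub>0 nat"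
  proof (induction n)
    case (Suc n)
    have "Poly_Mapping.single (Poly_Mapping.single i (Suc n) + m) c =
        T i * Poly_Mapping.single (Poly_Mapping.single i n + m) c"
      by (simp add: T_def mult_single flip: add.assoc single_add)
    then show ?case using assms(2)[OF Suc] by simp
  qed (use that in simp)
  {
    case (single i n)
    show ?case using *[OF assms(1), of i n] by simp
  next
    case (add f g)
    have "P (Poly_Mapping.single (h + g) c)" for h :: "nat \<Rightarrow>\<^sub>0 nat"
      using add(2)
    proof (induction h arbitrary: g rule: dpoly_induct)
      case (add h h')
      then show ?case by (simp add: add.assoc)
    qed (simp_all add: *)
    then show ?case .
  }
qed

lemma derivation_unique:
  assumes "k_derivation D" "\<And>i. D (T i) = T (Suc i)"
  shows "D = deriv"
proof
  fix f
  have add: "D (f + g) = D f + D g" and mult: "D (f * g) = D f * g + f * D g"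
    and scale: "D (Const c * f) = Const c * D f" for f g c
    using assms(1) by (auto simp: k_derivation_def)
  have "D 0 = 0" using add[of 0 0] by simp
  have "D 1 = 0" using mult[of 1 1] by simp
  then have C: "D (Const c) = 0" for c using scale[of c 1] by simp
  show "D f = deriv f"
  proof (induction f rule: dpoly_induct)
    case (single m c)
    show ?case
      by (induction m c rule: single_monom_induct)
        (simp_all add: C deriv_Const mult deriv_mult assms(2) deriv_T)
  qed (simp_all add: \<open>D 0 = 0\<close> add deriv_add)
qed

lemma differential_ideal_gen: "differential_ideal (diff_ideal_gen f)"
  unfolding differential_ideal_def diff_ideal_gen_def ideal_iff by auto

lemma diff_ideal_gen_eq_span:
  "diff_ideal_gen f = module.span (*) {(deriv ^^ n) f | n. True}" (is "_ = ?J")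
proof
  interpret module "(*) :: 'a dpoly \<Rightarrow> _" by (rule module_self)
  have "deriv x \<in> ?J" if "x \<in> ?J" for x
    using that
  proof (induction rule: span_induct_alt)
    case base
    then show ?case by (simp add: span_zero)
  next
    case (step c x y)
    then obtain n where x: "x = (deriv ^^ n) f" by auto
    have "deriv x = (deriv ^^ Suc n) f" by (simp add: x)
    then have "deriv x \<in> ?J" by (intro span_base) blast
    moreover have "x \<in> ?J" using step(1) by (rule span_base)
    ultimately show ?case
      using step by (simp add: deriv_add deriv_mult span_add span_scale)
  qed
  moreover have "f \<in> ?J"
    by (rule span_base) (auto intro: exI[of _ 0])
  ultimately show "diff_ideal_gen f \<subseteq> ?J"
    unfolding diff_ideal_gen_def differential_ideal_def by (auto simp: subspace_span)
  have "(deriv ^^ n) f \<in> diff_ideal_gen f" for n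
    by (induction n)
      (use differential_ideal_gen[of f] in \<open>auto simp: differential_ideal_def diff_ideal_gen_def\<close>)
  then show "?J \<subseteq> diff_ideal_gen f"
    using differential_ideal_gen[of f] by (intro span_minimal) (auto simp: differential_ideal_def)
qed

end

theory Submission
  imports Defs "HOL-Computational_Algebra.Formal_Power_Series" "HOL-Combinatorics.Permutations"
begin

text \<open>
  Write \<open>p = d + 1\<close>, so that the claimed index is \<open>(i + 1) d + 1\<close>.

  Upper bound: among the monomials of \<open>\<partial>\<^sup>n(T\<^sub>0\<^sup>p)\<close>, all of which occur in characteristic \<open>0\<close>,
  the balanced one \<open>T\<^sub>j\<^sup>s T\<^sub>j\<^sub>+\<^sub>1\<^sup>p\<^sup>-\<^sup>s\<close> has the strictly smallest sum of squared indices. Modulo the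
  ideal, a monomial divisible by it is therefore a combination of monomials of the same degree and
  weight (sum of the indices) with a larger sum of squares. If no two consecutive exponents add up
  to at least \<open>p\<close>, then a monomial of degree \<open>(i + 1) d + 1\<close> has weight larger than that of
  \<open>T\<^sub>i\<close> to the same power; hence the rewriting only ends by reaching \<open>0\<close>.

  Lower bound: let polynomials act on polynomials through \<open>T\<^sub>j \<mapsto> j! \<partial>/\<partial>T\<^sub>j\<close>. The generating
  function of \<open>\<partial>\<^sup>n(T\<^sub>0\<^sup>p) / n!\<close> then acts as the \<open>p\<close>-th power of the derivation
  \<open>\<Sum>\<^sub>k X\<^sup>k \<partial>/\<partial>T\<^sub>k\<close>, which sends the Hankel matrix \<open>(T\<^sub>r\<^sub>+\<^sub>s)\<close>, \<open>r, s \<le> i\<close>, to the rank-one matrix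
  \<open>(X\<^sup>r X\<^sup>s)\<close>. So its square kills the Hankel determinant \<open>u\<close> and its \<open>p\<close>-th power kills \<open>u\<^sup>d\<close>,
  whereas \<open>T\<^sub>i\<close> to the power \<open>(i + 1) d\<close> acts on \<open>u\<^sup>d\<close> as a nonzero constant, namely by extracting
  the product of the antidiagonal.
\<close>

section \<open>Derivations\<close>

locale ring_derivation =
  fixes D :: "'a::comm_ring_1 \<Rightarrow> 'a"
  assumes D_add: "D (f + g) = D f + D g"
    and D_mult: "D (f * g) = D f * g + f * D g"
begin

lemma D_0 [simp]: "D 0 = 0"
  using D_add[of 0 0] by simp

lemma D_1 [simp]: "D 1 = 0"
  using D_mult[of 1 1] by simp

lemma D_uminus: "D (- f) = - D f"
  using D_add[of f "- f"] by (simp add: eq_neg_iff_add_eq_0 add.commute)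

lemma D_diff: "D (f - g) = D f - D g"
  using D_add[of f "- g"] by (simp add: D_uminus)

lemma D_sum: "D (sum f A) = (\<Sum>x\<in>A. D (f x))"
  by (induction A rule: infinite_finite_induct) (simp_all add: D_add)

lemma D_of_nat [simp]: "D (of_nat n) = 0"
  by (induction n) (simp_all add: D_add)

lemma D_of_int [simp]: "D (of_int n) = 0"
  by (cases n) (simp_all add: D_uminus D_diff)

lemma funpow_D_0 [simp]: "(D ^^ n) 0 = 0"
  by (induction n) simp_all

lemma funpow_D_sum: "(D ^^ n) (sum f A) = (\<Sum>x\<in>A. (D ^^ n) (f x))"
  by (induction n) (simp_all add: D_sum)

lemma funpow_D_of_int_mult: "(D ^^ n) (of_int c * f) = of_int c * (D ^^ n) f"
  by (induction n) (simp_all add: D_mult)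

lemma funpow_D_eq_0:
  assumes "(D ^^ m) f = 0" "m \<le> n"
  shows "(D ^^ n) f = 0"
proof -
  have "(D ^^ n) f = (D ^^ (n - m)) ((D ^^ m) f)"
    using assms(2) by (simp flip: funpow_add o_apply[of "D ^^ (n - m)"])
  then show ?thesis using assms(1) by simp
qed

lemma Leibniz:
  "(D ^^ n) (f * g) = (\<Sum>k\<le>n. of_nat (n choose k) * (D ^^ k) f * (D ^^ (n - k)) g)"
proof (induction n)
  case (Suc n)
  let ?F = "\<lambda>k. (D ^^ k) f" and ?G = "\<lambda>k. (D ^^ k) g"
  have "(D ^^ Suc n) (f * g) =
      (\<Sum>k\<le>n. of_nat (n choose k) * ?F (Suc k) * ?G (n - k)) +
      (\<Sum>k\<le>n. of_nat (n choose k) * ?F k * ?G (Suc n - k))"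
    by (simp add: Suc D_sum D_mult sum.distrib algebra_simps Suc_diff_le)
  also have "(\<Sum>k\<le>n. of_nat (n choose k) * ?F k * ?G (Suc n - k)) =
      ?G (Suc n) * f + (\<Sum>k\<le>n. of_nat (n choose Suc k) * ?F (Suc k) * ?G (n - k))"
  proof -
    have "(\<Sum>k\<le>n. of_nat (n choose k) * ?F k * ?G (Suc n - k)) =
        (\<Sum>k\<le>Suc n. of_nat (n choose k) * ?F k * ?G (Suc n - k))"
      by (simp add: binomial_eq_0)
    then show ?thesis by (simp add: sum.atMost_Suc_shift mult.commute del: sum.atMost_Suc)
  qed
  also have "(\<Sum>k\<le>n. of_nat (n choose k) * ?F (Suc k) * ?G (n - k)) + \<dots> =
      (\<Sum>k\<le>Suc n. of_nat (Suc n choose k) * ?F k * ?G (Suc n - k))"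
    by (simp add: sum.atMost_Suc_shift sum.distrib algebra_simps del: sum.atMost_Suc)
  finally show ?case .
qed simp

text \<open>In the Leibniz sum a term dies unless \<open>f\<close> is hit at most \<open>a\<close>
  times and \<open>g\<close> at most \<open>b\<close> times. At total order \<open>a + b\<close>
  only \<open>k = a\<close> survives, and one order higher nothing does.\<close>

lemma funpow_D_mult_top:
  assumes "(D ^^ Suc a) f = 0" "(D ^^ Suc b) g = 0"
  shows "(D ^^ (a + b)) (f * g) = of_nat ((a + b) choose a) * (D ^^ a) f * (D ^^ b) g"
    and "(D ^^ Suc (a + b)) (f * g) = 0"
proof -
  have *: "(D ^^ k) f * (D ^^ l) g = 0" if "k > a \<or> l > b" for k l
    using that funpow_D_eq_0[OF assms(1), of k] funpow_D_eq_0[OF assms(2), of l] by fastforce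
  have "(D ^^ (a + b)) (f * g) =
      (\<Sum>k\<le>a+b. if k = a then of_nat ((a + b) choose a) * (D ^^ a) f * (D ^^ b) g else 0)"
    unfolding Leibniz
  proof (rule sum.cong[OF refl], goal_cases)
    case (1 k)
    have "(D ^^ k) f * (D ^^ (a + b - k)) g = 0" if "k \<noteq> a"
      using 1 that by (intro *) auto
    then show ?case by (auto simp: mult.assoc)
  qed
  then show "(D ^^ (a + b)) (f * g) = of_nat ((a + b) choose a) * (D ^^ a) f * (D ^^ b) g"
    by simp
  show "(D ^^ Suc (a + b)) (f * g) = 0"
    unfolding Leibniz
  proof (intro sum.neutral ballI, goal_cases)
    case (1 k)
    have "(D ^^ k) f * (D ^^ (Suc (a + b) - k)) g = 0"
      using 1 by (intro *) auto
    then show ?case by (simp only: mult.assoc mult_zero_right)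
  qed
qed

text \<open>The constant is a product of binomial coefficients. Only its positivity is recorded,
  which is what characteristic 0 needs.\<close>

lemma funpow_D_power_top:
  assumes "(D ^^ Suc d) u = 0"
  shows "(D ^^ Suc (d * n)) (u ^ n) = 0 \<and>
    (\<exists>c>0. (D ^^ (d * n)) (u ^ n) = of_nat c * (D ^^ d) u ^ n)"
proof (induction n)
  case 0
  show ?case by (auto intro: exI[of _ 1])
next
  case (Suc n)
  then obtain c where c: "c > 0" "(D ^^ (d * n)) (u ^ n) = of_nat c * (D ^^ d) u ^ n"
    and 0: "(D ^^ Suc (d * n)) (u ^ n) = 0" by blast
  have "(D ^^ (d * Suc n)) (u ^ Suc n) =
      of_nat ((d + d * n) choose d) * (D ^^ d) u * (of_nat c * (D ^^ d) u ^ n)"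
    using funpow_D_mult_top(1)[OF assms 0] c(2) by simp
  also have "\<dots> = of_nat (((d + d * n) choose d) * c) * (D ^^ d) u ^ Suc n"
    by (simp add: algebra_simps)
  finally show ?case
    using funpow_D_mult_top(2)[OF assms 0] c(1)
    by (intro conjI exI[of _ "((d + d * n) choose d) * c"]) (simp_all)
qed

text \<open>A surviving term differentiates each factor exactly once; the factorial counts the
  orders in which this can happen.\<close>

lemma funpow_D_prod_top:
  assumes "finite A" "\<And>r. r \<in> A \<Longrightarrow> D (D (f r)) = 0"
  shows "(D ^^ Suc (card A)) (prod f A) = 0 \<and>
    (D ^^ card A) (prod f A) = of_nat (fact (card A)) * (\<Prod>r\<in>A. D (f r))"
  using assms
proof (induction A)
  case (insert r A)
  have 1: "(D ^^ Suc 1) (f r) = 0" using insert.prems by simp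
  have 2: "(D ^^ Suc (card A)) (prod f A) = 0" using insert by blast
  show ?case
    using funpow_D_mult_top[OF 1 2] insert by (simp add: algebra_simps)
qed simp

lemma D_prod:
  "finite A \<Longrightarrow> D (prod f A) = (\<Sum>r\<in>A. D (f r) * prod f (A - {r}))"
proof (induction A rule: finite_induct)
  case (insert x A)
  have "(\<Sum>r\<in>A. D (f r) * prod f (insert x A - {r})) = f x * (\<Sum>r\<in>A. D (f r) * prod f (A - {r}))"
    unfolding sum_distrib_left
  proof (rule sum.cong[OF refl], goal_cases)
    case (1 r)
    then have "insert x A - {r} = insert x (A - {r})" using insert by auto
    then show ?case using insert by (simp add: algebra_simps)
  qed
  then show ?case using insert by (simp add: D_mult)
qed simp

text \<open>
  The determinant of \<open>H + s v v\<^sup>T\<close> is affine in \<open>s\<close>: in its second derivative the terms of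
  \<open>\<sigma>\<close> and \<open>\<sigma> \<circ> (r r')\<close> cancel.
\<close>

lemma D_D_det_rank_one:
  fixes h :: "'b \<Rightarrow> 'b \<Rightarrow> 'a"
  assumes "finite A" and double: "\<And>x::'a. x + x = 0 \<Longrightarrow> x = 0"
    and h: "\<And>r s. D (h r s) = v r * v s" and v: "\<And>r. D (v r) = 0"
  shows "D (D (\<Sum>\<sigma> | \<sigma> permutes A. of_int (sign \<sigma>) * (\<Prod>r\<in>A. h r (\<sigma> r)))) = 0"
proof -
  \<comment> \<open>The contribution of \<open>\<sigma>\<close> in which the factor of row
    \<open>r\<close> is differentiated first and that of row \<open>r'\<close> second.\<close>
  let ?t = "\<lambda>r r' \<sigma>. of_int (sign \<sigma>) *
    (v r * v (\<sigma> r) * (v r' * v (\<sigma> r')) * (\<Prod>s\<in>A - {r} - {r'}. h s (\<sigma> s)))"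
  have "D (D (of_int (sign \<sigma>) * (\<Prod>r\<in>A. h r (\<sigma> r)))) = (\<Sum>r\<in>A. \<Sum>r'\<in>A - {r}. ?t r r' \<sigma>)" for \<sigma>
    using \<open>finite A\<close>
    by (simp add: D_mult D_prod D_sum h v sum_distrib_left mult.assoc)
  then have "D (D (\<Sum>\<sigma> | \<sigma> permutes A. of_int (sign \<sigma>) * (\<Prod>r\<in>A. h r (\<sigma> r)))) =
      (\<Sum>\<sigma> | \<sigma> permutes A. \<Sum>r\<in>A. \<Sum>r'\<in>A - {r}. ?t r r' \<sigma>)"
    by (simp add: D_sum)
  also have "\<dots> = (\<Sum>r\<in>A. \<Sum>r'\<in>A - {r}. \<Sum>\<sigma> | \<sigma> permutes A. ?t r r' \<sigma>)"
    by (subst sum.swap, rule sum.cong[OF refl], subst sum.swap) simp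
  also have "\<dots> = 0"
  proof (rule sum.neutral, rule ballI, rule sum.neutral, rule ballI, goal_cases)
    case (1 r r')
    let ?\<tau> = "transpose r r'"
    have neq: "r \<noteq> r'" using 1 by auto
    have \<tau>: "?\<tau> permutes A" using 1 by (intro permutes_swap_id) auto
    have "(\<Sum>\<sigma> | \<sigma> permutes A. ?t r r' \<sigma>) = (\<Sum>\<sigma> | \<sigma> permutes A. ?t r r' (\<sigma> \<circ> ?\<tau>))"
      by (rule sum_permutations_compose_right[OF \<tau>])
    also have "\<dots> = (\<Sum>\<sigma> | \<sigma> permutes A. - ?t r r' \<sigma>)"
    proof (rule sum.cong[OF refl], goal_cases)
      case (1 \<sigma>)
      have "permutation \<sigma>" using 1 \<open>finite A\<close> by (auto simp: permutation_permutes)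
      then have "sign (\<sigma> \<circ> ?\<tau>) = - sign \<sigma>"
        using neq by (simp add: sign_compose permutation_swap_id sign_swap_id)
      moreover have "(\<Prod>s\<in>A - {r} - {r'}. h s (\<sigma> (?\<tau> s))) = (\<Prod>s\<in>A - {r} - {r'}. h s (\<sigma> s))"
        by (rule prod.cong) auto
      ultimately show ?case by (simp add: algebra_simps)
    qed
    also have "\<dots> = - (\<Sum>\<sigma> | \<sigma> permutes A. ?t r r' \<sigma>)" by (rule sum_negf)
    finally show ?case by (rule double[OF eq_neg_iff_add_eq_0[THEN iffD1]])
  qed
  finally show ?thesis .
qed

end

interpretation deriv: ring_derivation deriv
  by unfold_locales (rule deriv_add deriv_mult)+

section \<open>Monomials and their weights\<close>

abbreviation e :: "nat \<Rightarrow> (nat \<Rightarrow>\<^sub>0 nat)" where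
  "e j \<equiv> Poly_Mapping.single j (Suc 0)"

lemma T_mult_single: "T j * Poly_Mapping.single m a = Poly_Mapping.single (m + e j) a"
  by (simp add: T_def mult_single add.commute)

lemma add_diff_e:
  "Poly_Mapping.lookup m j \<noteq> 0 \<Longrightarrow> m - e j + e j = m"
  by (rule poly_mapping_eqI) (auto simp: lookup_add lookup_minus lookup_single when_def)

lemma lookup_T_mult:
  "Poly_Mapping.lookup (T j * f) m =
    (if Poly_Mapping.lookup m j = 0 then 0 else Poly_Mapping.lookup f (m - e j))"
proof (induction f rule: dpoly_induct)
  case (single n a)
  have "n + e j = m \<longleftrightarrow> Poly_Mapping.lookup m j \<noteq> 0 \<and> n = m - e j"
    using add_diff_e[of m j] by (auto simp: lookup_add)
  then show ?case by (auto simp: T_mult_single lookup_single when_def)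
qed (simp_all add: distrib_left lookup_add)

text \<open>Integer values admit weights that are negative at small indices, as in
  \<open>exists_dense_pair\<close>.\<close>

definition wsum :: "(nat \<Rightarrow> int) \<Rightarrow> (nat \<Rightarrow>\<^sub>0 nat) \<Rightarrow> int" where
  "wsum w m = (\<Sum>j\<in>Poly_Mapping.keys m. int (Poly_Mapping.lookup m j) * w j)"

abbreviation deg :: "(nat \<Rightarrow>\<^sub>0 nat) \<Rightarrow> int" where "deg \<equiv> wsum (\<lambda>_. 1)"
abbreviation wt :: "(nat \<Rightarrow>\<^sub>0 nat) \<Rightarrow> int" where "wt \<equiv> wsum int"
abbreviation sq :: "(nat \<Rightarrow>\<^sub>0 nat) \<Rightarrow> int" where "sq \<equiv> wsum (\<lambda>j. int j * int j)"

lemma wsum_superset: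
  assumes "finite S" "Poly_Mapping.keys m \<subseteq> S"
  shows "wsum w m = (\<Sum>j\<in>S. int (Poly_Mapping.lookup m j) * w j)"
  unfolding wsum_def by (rule sum.mono_neutral_left) (use assms in \<open>auto simp: in_keys_iff\<close>)

lemma wsum_add: "wsum w (m + n) = wsum w m + wsum w n"
proof -
  let ?S = "Poly_Mapping.keys m \<union> Poly_Mapping.keys n"
  show ?thesis
    by (simp add: wsum_superset[of ?S] keys_add_nat lookup_add distrib_right sum.distrib)
qed

lemma wsum_single [simp]: "wsum w (Poly_Mapping.single j a) = int a * w j"
  by (subst wsum_superset[of "{j}"]) auto

lemma wsum_0 [simp]: "wsum w 0 = 0"
  by (simp add: wsum_def)

lemma wsum_diff_e:
  "Poly_Mapping.lookup m j \<noteq> 0 \<Longrightarrow> wsum w (m - e j) = wsum w m - w j"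
  using wsum_add[of w "m - e j" "e j"] by (simp add: add_diff_e)

lemma lookup_le_wt: "Poly_Mapping.lookup m j \<noteq> 0 \<Longrightarrow> int j \<le> wt m"
proof -
  assume j: "Poly_Mapping.lookup m j \<noteq> 0"
  have "0 \<le> wt (m - e j)" by (simp add: wsum_def sum_nonneg)
  then show ?thesis using wsum_diff_e[OF j, of int] by simp
qed

text \<open>Every index occurring in \<open>m\<close> is at most \<open>wt m\<close>. The bound
  makes \<open>wt m * wt m - sq m\<close> usable as an induction measure.\<close>

lemma sq_le: "sq m \<le> wt m * wt m"
proof -
  have "sq m \<le> (\<Sum>j\<in>Poly_Mapping.keys m. wt m * (int (Poly_Mapping.lookup m j) * int j))"
    unfolding wsum_def[of "\<lambda>j. int j * int j"]
  proof (rule sum_mono, goal_cases)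
    case (1 j)
    then have "int j \<le> wt m" by (intro lookup_le_wt) (simp add: in_keys_iff)
    then show ?case
      using mult_right_mono[of "int j" "wt m" "int (Poly_Mapping.lookup m j) * int j"]
      by (simp add: ac_simps)
  qed
  then show ?thesis by (simp add: wsum_def sum_distrib_left)
qed

lemma deg_eq_0_iff: "deg m = 0 \<longleftrightarrow> m = 0"
proof
  assume "deg m = 0"
  then have "\<forall>j\<in>Poly_Mapping.keys m. Poly_Mapping.lookup m j = 0"
    by (simp add: wsum_def sum_nonneg_eq_0_iff)
  then show "m = 0" by (intro poly_mapping_eqI) (auto simp: in_keys_iff)
qed simp

text \<open>The denominator of the coefficient of \<open>m\<close> in a power of
  \<open>\<Sum>j. T j * X^j / j!\<close>, and later the pairing of the monomial \<open>m\<close>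
  with itself.\<close>

definition monom_fact :: "(nat \<Rightarrow>\<^sub>0 nat) \<Rightarrow> 'k::field_char_0" where
  "monom_fact m = (\<Prod>j\<in>Poly_Mapping.keys m.
     fact (Poly_Mapping.lookup m j) * fact j ^ Poly_Mapping.lookup m j)"

lemma monom_fact_neq_0 [simp]: "monom_fact m \<noteq> 0"
  by (simp add: monom_fact_def)

lemma monom_fact_0 [simp]: "monom_fact 0 = 1"
  by (simp add: monom_fact_def)

lemma monom_fact_superset:
  assumes "finite S" "Poly_Mapping.keys m \<subseteq> S"
  shows "monom_fact m = (\<Prod>j\<in>S.
     fact (Poly_Mapping.lookup m j) * fact j ^ Poly_Mapping.lookup m j)"
  unfolding monom_fact_def
  by (rule prod.mono_neutral_left) (use assms in \<open>auto simp: in_keys_iff\<close>)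

lemma monom_fact_add_e:
  "monom_fact (m + e j) =
     (monom_fact m :: 'k::field_char_0) * (of_nat (Suc (Poly_Mapping.lookup m j)) * fact j)"
proof -
  let ?S = "insert j (Poly_Mapping.keys m)"
  let ?f = "\<lambda>m l. fact (Poly_Mapping.lookup m l) * fact l ^ Poly_Mapping.lookup m l :: 'k"
  have "monom_fact (m + e j) = prod (?f (m + e j)) ?S"
    by (rule monom_fact_superset) (use keys_add_nat[of m "e j"] in auto)
  also have "\<dots> = ?f (m + e j) j * prod (?f (m + e j)) (?S - {j})"
    by (rule prod.remove) auto
  also have "prod (?f (m + e j)) (?S - {j}) = prod (?f m) (?S - {j})"
    by (rule prod.cong) (auto simp: lookup_add lookup_single_not_eq)
  also have "?f (m + e j) j = of_nat (Suc (Poly_Mapping.lookup m j)) * fact j * ?f m j"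
    by (simp add: lookup_add algebra_simps)
  also have "\<dots> * prod (?f m) (?S - {j}) =
      (of_nat (Suc (Poly_Mapping.lookup m j)) * fact j) * prod (?f m) ?S"
    by (subst (2) prod.remove[of _ j]) (auto simp: mult.assoc)
  also have "prod (?f m) ?S = monom_fact m"
    by (rule monom_fact_superset[symmetric]) auto
  finally show ?thesis by (simp only: mult.commute)
qed

lemma monom_fact_diff_e:
  assumes "Poly_Mapping.lookup m j \<noteq> 0"
  shows "(monom_fact m :: 'k::field_char_0) =
    monom_fact (m - e j) * (of_nat (Poly_Mapping.lookup m j) * fact j)"
  using monom_fact_add_e[of "m - e j" j] assms by (simp add: add_diff_e lookup_minus)

section \<open>Coefficients of the iterated derivatives of a power of \<open>T 0\<close>\<close>

lemma funpow_deriv_T: "(deriv ^^ n) (T j) = T (n + j)"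
  by (induction n) (simp_all add: deriv_T)

lemma funpow_deriv_T0_power_Suc:
  "(deriv ^^ n) (T 0 ^ Suc p :: 'k::field_char_0 dpoly) =
     (\<Sum>k\<le>n. of_nat (n choose k) * (T k * (deriv ^^ (n - k)) (T 0 ^ p)))"
  by (simp add: deriv.Leibniz funpow_deriv_T mult.assoc)

lemma lookup_Const_mult:
  "Poly_Mapping.lookup (Const c * f) m = c * Poly_Mapping.lookup f m"
  by (induction f rule: dpoly_induct)
    (simp_all add: mult_single lookup_single when_def distrib_left lookup_add)

lemma lookup_of_nat_mult:
  "Poly_Mapping.lookup (of_nat c * f :: 'k::field_char_0 dpoly) m = of_nat c * Poly_Mapping.lookup f m"
  using lookup_Const_mult[of "of_nat c" f m] by simp

text \<open>This is the multinomial theorem for the \<open>p\<close>-th power of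
  \<open>\<Sum>j. T j * X^j / j!\<close>, the exponential generating function of the derivatives;
  the induction splits off one factor \<open>T 0\<close>.\<close>

lemma lookup_funpow_deriv_T0_power:
  "Poly_Mapping.lookup ((deriv ^^ n) (T 0 ^ p) :: 'k::field_char_0 dpoly) m =
     (if deg m = int p \<and> wt m = int n then fact n * fact p / monom_fact m else 0)"
proof (induction p arbitrary: n m)
  case 0
  have "(deriv ^^ n) (T 0 ^ 0 :: 'k dpoly) = (if n = 0 then 1 else 0)"
    by (cases n) (simp_all add: funpow_swap1)
  then show ?case by (auto simp: deg_eq_0_iff lookup_one when_def)
next
  case (Suc p)
  let ?l = "Poly_Mapping.lookup m"
  let ?P = "deg m = int (Suc p) \<and> wt m = int n"
  have "Poly_Mapping.lookup ((deriv ^^ n) (T 0 ^ Suc p) :: 'k dpoly) m =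
      (\<Sum>k\<le>n. of_nat (n choose k) * Poly_Mapping.lookup (T k * (deriv ^^ (n - k)) (T 0 ^ p) :: 'k dpoly) m)"
    unfolding funpow_deriv_T0_power_Suc by (simp add: lookup_sum lookup_of_nat_mult)
  \<comment> \<open>Removing one \<open>T k\<close> from \<open>m\<close> divides
    \<open>monom_fact m\<close> by \<open>k!\<close> times the exponent \<open>?l k\<close>, so the
    index \<open>k\<close> contributes in proportion to that exponent.\<close>
  also have "\<dots> = (\<Sum>k\<le>n. if ?P then fact n * fact p / monom_fact m * of_nat (?l k) else 0)"
  proof (rule sum.cong[OF refl], goal_cases)
    case (1 k)
    show ?case
    proof (cases "?l k = 0")
      case False
      have "deg (m - e k) = int p \<and> wt (m - e k) = int (n - k) \<longleftrightarrow> ?P"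
        using 1 by (auto simp: wsum_diff_e[OF False] of_nat_diff)
      then show ?thesis
        using 1 False
        by (simp add: lookup_T_mult Suc monom_fact_diff_e[OF False] binomial_fact divide_simps)
    qed (simp add: lookup_T_mult)
  qed
  also have "\<dots> = (if ?P then fact n * fact p / monom_fact m * of_nat (\<Sum>k\<le>n. ?l k) else 0)"
  proof (cases ?P)
    case True
    then show ?thesis by (simp add: sum_distrib_left)
  next
    case False
    then show ?thesis by (simp only: if_False sum.neutral_const)
  qed
  also have "\<dots> = (if ?P then fact n * fact (Suc p) / monom_fact m else 0)"
  proof (cases ?P)
    case True
    \<comment> \<open>Indices occurring in \<open>m\<close> are at most its weight \<open>n\<close>,
      so the exponents up to \<open>n\<close> add up to the full degree, turning
      \<open>fact p\<close> into \<open>fact (Suc p)\<close>.\<close>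
    have "deg m = (\<Sum>k\<le>n. int (?l k) * 1)"
    proof (rule wsum_superset)
      show "Poly_Mapping.keys m \<subseteq> {..n}"
        using lookup_le_wt[of m] True by (auto simp: in_keys_iff)
    qed simp
    then have "(\<Sum>k\<le>n. ?l k) = Suc p" using True by (simp flip: of_nat_sum)
    then show ?thesis by (simp add: algebra_simps)
  next
    case False
    then show ?thesis by (simp only: if_False)
  qed
  finally show ?case .
qed


section \<open>The upper bound\<close>

lemma ideal_gen:
  "0 \<in> diff_ideal_gen f"
  "x \<in> diff_ideal_gen f \<Longrightarrow> y \<in> diff_ideal_gen f \<Longrightarrow> x + y \<in> diff_ideal_gen f"
  "x \<in> diff_ideal_gen f \<Longrightarrow> a * x \<in> diff_ideal_gen f"
  using differential_ideal_gen[of f] unfolding differential_ideal_def ideal_iff by blast+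

lemma ideal_gen_diff:
  "x \<in> diff_ideal_gen f \<Longrightarrow> y \<in> diff_ideal_gen f \<Longrightarrow> x - y \<in> diff_ideal_gen f"
  using ideal_gen(2)[of x f "- 1 * y"] ideal_gen(3)[of y f "- 1"] by simp

lemma ideal_gen_sum:
  "(\<And>x. x \<in> A \<Longrightarrow> g x \<in> diff_ideal_gen f) \<Longrightarrow> sum g A \<in> diff_ideal_gen f"
  by (induction A rule: infinite_finite_induct) (auto intro: ideal_gen)

lemma funpow_deriv_in_ideal_gen: "(deriv ^^ n) f \<in> diff_ideal_gen f"
  unfolding diff_ideal_gen_eq_span
  by (rule module.span_base[OF module_self]) blast

text \<open>
  On monomials of fixed degree and weight, \<open>sq\<close> differs by a constant from the weighted sum of
  \<open>(l - j) (l - j - 1)\<close>, which is nonnegative and vanishes only on \<open>{j, j + 1}\<close>.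
\<close>

lemma balanced_monom_sq_less:
  assumes "deg m = int (a + b)" "wt m = int (a * j + b * Suc j)"
    and "m \<noteq> Poly_Mapping.single j a + Poly_Mapping.single (Suc j) b"
  shows "sq (Poly_Mapping.single j a + Poly_Mapping.single (Suc j) b) < sq m"
proof -
  let ?b = "Poly_Mapping.single j a + Poly_Mapping.single (Suc j) b"
  let ?w = "\<lambda>l. (int l - int j) * (int l - int (Suc j))"
  let ?l = "Poly_Mapping.lookup m"
  have w: "wsum ?w n = sq n - (2 * int j + 1) * wt n + int j * (int j + 1) * deg n" for n
    by (simp add: wsum_def sum_distrib_left algebra_simps flip: sum.distrib sum_subtractf)
  have w_pos: "?w l > 0" if "l \<noteq> j" "l \<noteq> Suc j" for l
    using that by (cases "l < j") (auto intro: mult_neg_neg mult_pos_pos)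
  have nonneg: "int (?l l) * ?w l \<ge> 0" for l
    using w_pos[of l] by (cases "l = j \<or> l = Suc j") auto
  have "wsum ?w m > 0"
  proof (rule ccontr)
    assume "\<not> wsum ?w m > 0"
    then have "wsum ?w m = 0"
      using nonneg by (auto simp: wsum_def intro!: antisym sum_nonneg)
    then have terms: "\<forall>l\<in>Poly_Mapping.keys m. int (?l l) * ?w l = 0"
      using nonneg by (simp add: wsum_def sum_nonneg_eq_0_iff)
    have 0: "?l l = 0" if "l \<noteq> j" "l \<noteq> Suc j" for l
    proof (rule ccontr)
      assume "?l l \<noteq> 0"
      then have "l \<in> Poly_Mapping.keys m" by (simp add: in_keys_iff)
      then have "int (?l l) * ?w l = 0" by (rule bspec[OF terms])
      then show False using w_pos[OF that] \<open>?l l \<noteq> 0\<close> by auto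
    qed
    have m: "m = Poly_Mapping.single j (?l j) + Poly_Mapping.single (Suc j) (?l (Suc j))"
      by (rule poly_mapping_eqI) (auto simp: lookup_add lookup_single when_def 0)
    define x y where "x = ?l j" and "y = ?l (Suc j)"
    have m: "m = Poly_Mapping.single j x + Poly_Mapping.single (Suc j) y"
      using m by (simp add: x_def y_def)
    have "x + y = a + b"
      using assms(1) unfolding m by (simp add: wsum_add flip: of_nat_add)
    moreover have "int x * int j + int y * (int j + 1) = int a * int j + int b * (int j + 1)"
      using assms(2) unfolding m by (simp add: wsum_add algebra_simps)
    moreover from \<open>x + y = a + b\<close> have "int x = int a + int b - int y" by linarith
    ultimately have "y = b" by (simp add: algebra_simps)
    then have "x = a" using \<open>x + y = a + b\<close> by simp
    then show False using assms(3) m \<open>y = b\<close> by simp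
  qed
  moreover have "wsum ?w ?b = 0" by (simp add: wsum_add)
  moreover have "deg ?b = deg m" "wt ?b = wt m" using assms by (simp_all add: wsum_add algebra_simps)
  ultimately show ?thesis using w[of m] w[of ?b] by simp
qed

lemma sum_pairs: "(\<Sum>j<2 * N. f j) = (\<Sum>l<N. f (2 * l) + f (Suc (2 * l)))"
  for f :: "nat \<Rightarrow> 'a::comm_monoid_add"
  by (induction N) (simp_all add: add.assoc)

text \<open>Otherwise each pair of indices \<open>2l, 2l + 1\<close> carries degree at most
  \<open>d\<close>. The cheapest filling puts \<open>d\<close> at each of
  \<open>0, 2, ..., 2i\<close> and the last unit at \<open>2(i + 1)\<close>, with weight
  \<open>d i (i + 1) + 2(i + 1)\<close>, above the bound. Shifting the weight by
  \<open>2(i + 1)\<close> turns this into a termwise estimate.\<close>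

lemma exists_dense_pair:
  assumes deg: "deg m = int (Suc i * d + 1)" and wt: "wt m \<le> int (i * (Suc i * d + 1))"
  shows "\<exists>j. d < Poly_Mapping.lookup m j + Poly_Mapping.lookup m (Suc j)"
proof (rule ccontr)
  let ?l = "\<lambda>j. int (Poly_Mapping.lookup m j)"
  assume "\<not> ?thesis"
  then have le: "?l j + ?l (Suc j) \<le> int d" for j
    by (auto simp: not_less simp flip: of_nat_add)
  obtain N0 where N0: "Poly_Mapping.keys m \<subseteq> {..<N0}"
    using finite_nat_set_iff_bounded[of "Poly_Mapping.keys m"] by auto
  define N where "N = N0 + Suc i"
  have keys: "Poly_Mapping.keys m \<subseteq> {..<2 * N}" using N0 by (force simp: N_def)
  have "wsum (\<lambda>j. int j - 2 * int (Suc i)) m \<ge> - (int d * int (Suc i) * (int i + 2))"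
  proof -
    have arith: "(\<Sum>l<k. 2 * (int l - c)) = int k * (int k - 1 - 2 * c)" for k c
      by (induction k) (simp_all add: algebra_simps)
    have "- (int d * int (Suc i) * (int i + 2)) = int d * (\<Sum>l<Suc i. 2 * (int l - int (Suc i)))"
      unfolding arith by (simp add: algebra_simps)
    also have "\<dots> = (\<Sum>l<Suc i. int d * (2 * (int l - int (Suc i))))"
      by (simp only: sum_distrib_left)
    also have "\<dots> = (\<Sum>l<N. if l < Suc i then int d * (2 * (int l - int (Suc i))) else 0)"
      by (rule sum.mono_neutral_cong_left) (auto simp: N_def)
    \<comment> \<open>For \<open>l \<le> i\<close> the factor is negative and the pair is bounded by
      \<open>d\<close>; for larger \<open>l\<close> the summand is nonnegative.\<close>
    also have "\<dots> \<le> (\<Sum>l<N. (?l (2 * l) + ?l (Suc (2 * l))) * (2 * (int l - int (Suc i))))"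
      using le by (intro sum_mono) (auto intro: mult_right_mono_neg)
    also have "\<dots> \<le> (\<Sum>l<N. ?l (2 * l) * (int (2 * l) - 2 * int (Suc i)) +
          ?l (Suc (2 * l)) * (int (Suc (2 * l)) - 2 * int (Suc i)))"
      by (rule sum_mono) (simp add: algebra_simps)
    also have "\<dots> = wsum (\<lambda>j. int j - 2 * int (Suc i)) m"
      by (subst wsum_superset[OF _ keys]) (simp_all only: sum_pairs finite_lessThan)
    finally show ?thesis .
  qed
  moreover have "wsum (\<lambda>j. int j - 2 * int (Suc i)) m = wt m - 2 * int (Suc i) * deg m"
    by (simp add: wsum_def sum_distrib_left algebra_simps sum.distrib sum_subtractf)
  ultimately have "wt m \<ge> 2 * int (Suc i) * deg m - int d * int (Suc i) * (int i + 2)"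
    by linarith
  then show False
    using wt unfolding deg by (simp add: algebra_simps)
qed

text \<open>Rewriting preserves degree and weight, hence the hypotheses, and raises
  \<open>sq\<close>. No base case is needed: a dense pair always exists, and once \<open>sq\<close>
  cannot grow the remainder is an empty sum.\<close>

lemma single_in_ideal_gen:
  fixes a :: "'k::field_char_0"
  assumes "deg m = int (Suc i * d + 1)" "wt m \<le> int (i * (Suc i * d + 1))"
  shows "Poly_Mapping.single m a \<in> diff_ideal_gen (T 0 ^ Suc d)"
  using assms
proof (induction "nat (wt m * wt m - sq m)" arbitrary: m a rule: less_induct)
  case less
  let ?I = "diff_ideal_gen (T 0 ^ Suc d :: 'k dpoly)"
  let ?l = "Poly_Mapping.lookup m"
  obtain j where j: "d < ?l j + ?l (Suc j)" using exists_dense_pair[OF less.prems] ..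
  \<comment> \<open>The balanced monomial of degree \<open>d + 1\<close> takes as much of
    \<open>T j\<close> as is available and the rest from \<open>T (Suc j)\<close>.\<close>
  define s t where "s = min (Suc d) (?l j)" and "t = Suc d - s"
  have st: "s \<le> ?l j" "t \<le> ?l (Suc j)" "s + t = Suc d" using j by (auto simp: s_def t_def)
  define \<beta> where "\<beta> = Poly_Mapping.single j s + Poly_Mapping.single (Suc j) t"
  define \<nu> where "\<nu> = m - \<beta>"
  have m: "m = \<nu> + \<beta>"
    by (rule poly_mapping_eqI)
      (use st in \<open>auto simp: \<nu>_def \<beta>_def lookup_add lookup_minus lookup_single when_def\<close>)
  define F :: "'k dpoly" where "F = (deriv ^^ (s * j + t * Suc j)) (T 0 ^ Suc d)"
  have F: "F \<in> ?I" unfolding F_def by (rule funpow_deriv_in_ideal_gen)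
  have \<beta>: "deg \<beta> = int (Suc d)" "wt \<beta> = int (s * j + t * Suc j)"
    by (simp_all add: \<beta>_def wsum_add algebra_simps flip: st(3))
  have F\<beta>: "Poly_Mapping.lookup F \<beta> \<noteq> 0"
    unfolding F_def lookup_funpow_deriv_T0_power using \<beta> by (simp del: fact_Suc)
  \<comment> \<open>Normalised so that \<open>m\<close> occurs with coefficient \<open>a\<close> in
    the multiple of \<open>F\<close> by the cofactor \<open>\<nu>\<close>.\<close>
  define c where "c = a / Poly_Mapping.lookup F \<beta>"
  have expand: "F = (\<Sum>\<kappa>\<in>Poly_Mapping.keys F. Poly_Mapping.single \<kappa> (Poly_Mapping.lookup F \<kappa>))"
    
    by (rule poly_mapping_eqI) (simp add: lookup_sum lookup_single when_def in_keys_iff)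
  have others: "Poly_Mapping.single (\<nu> + \<kappa>) b \<in> ?I"
    if "\<kappa> \<in> Poly_Mapping.keys F - {\<beta>}" for \<kappa> b
  proof -
    have \<kappa>: "deg \<kappa> = int (Suc d)" "wt \<kappa> = int (s * j + t * Suc j)"
    proof -
      have "Poly_Mapping.lookup F \<kappa> \<noteq> 0" using that by (simp add: in_keys_iff)
      then show "deg \<kappa> = int (Suc d)" "wt \<kappa> = int (s * j + t * Suc j)"
        unfolding F_def lookup_funpow_deriv_T0_power by metis+
    qed
    have "sq \<beta> < sq \<kappa>"
      using balanced_monom_sq_less[of \<kappa> s t j] \<kappa> that st(3) by (simp add: \<beta>_def)
    then have "sq m < sq (\<nu> + \<kappa>)" by (simp add: m wsum_add)
    moreover have eq: "deg (\<nu> + \<kappa>) = deg m" "wt (\<nu> + \<kappa>) = wt m"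
      using \<kappa> \<beta> by (simp_all add: m wsum_add)
    moreover have "sq (\<nu> + \<kappa>) \<le> wt (\<nu> + \<kappa>) * wt (\<nu> + \<kappa>)"
      by (rule sq_le)
    ultimately show ?thesis
      using less.prems by (intro less.hyps) (simp_all add: nat_mono_iff)
  qed
  have "Poly_Mapping.single \<nu> c * F =
      (\<Sum>\<kappa>\<in>Poly_Mapping.keys F. Poly_Mapping.single (\<nu> + \<kappa>) (c * Poly_Mapping.lookup F \<kappa>))"
    by (subst expand) (simp add: sum_distrib_left mult_single)
  also have "\<dots> = Poly_Mapping.single m a +
      (\<Sum>\<kappa>\<in>Poly_Mapping.keys F - {\<beta>}. Poly_Mapping.single (\<nu> + \<kappa>) (c * Poly_Mapping.lookup F \<kappa>))"
    using F\<beta> by (subst sum.remove[of _ \<beta>]) (auto simp: in_keys_iff m c_def)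
  finally have "Poly_Mapping.single m a = Poly_Mapping.single \<nu> c * F -
      (\<Sum>\<kappa>\<in>Poly_Mapping.keys F - {\<beta>}. Poly_Mapping.single (\<nu> + \<kappa>) (c * Poly_Mapping.lookup F \<kappa>))"
    by simp
  then show ?case
    by (simp only:) (intro ideal_gen_diff ideal_gen(3) ideal_gen_sum F others)
qed

lemma T_power: "T i ^ n = Poly_Mapping.single (Poly_Mapping.single i n) 1"
  by (induction n) (simp_all add: T_mult_single flip: single_add)

lemma T_power_in_ideal_gen:
  "(T i :: 'k::field_char_0 dpoly) ^ (Suc i * d + 1) \<in> diff_ideal_gen (T 0 ^ Suc d)"
  unfolding T_power[of i] by (rule single_in_ideal_gen[where i = i]) (simp_all add: algebra_simps)


section \<open>The lower bound\<close>

definition pd :: "nat \<Rightarrow> 'k::field_char_0 dpoly \<Rightarrow> 'k dpoly" where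
  "pd j f = Abs_poly_mapping
     (\<lambda>m. of_nat (Suc (Poly_Mapping.lookup m j)) * Poly_Mapping.lookup f (m + e j))"

lemma lookup_pd:
  "Poly_Mapping.lookup (pd j f) m =
     of_nat (Suc (Poly_Mapping.lookup m j)) * Poly_Mapping.lookup f (m + e j)"
proof -
  \<comment> \<open>Injectivity of the shift by \<open>e j\<close> gives the finite support that
    \<open>Abs_poly_mapping\<close> requires.\<close>
  have "finite ((\<lambda>m. m + e j) -` Poly_Mapping.keys f)"
    by (intro finite_vimageI) (auto simp: inj_on_def)
  then have "finite {m. of_nat (Suc (Poly_Mapping.lookup m j)) * Poly_Mapping.lookup f (m + e j) \<noteq> 0}"
    by (rule rev_finite_subset) (auto simp: in_keys_iff)
  then show ?thesis unfolding pd_def by (subst lookup_Abs_poly_mapping) simp_all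
qed

lemma pd_add: "pd j (f + g) = pd j f + pd j g"
  by (rule poly_mapping_eqI) (simp add: lookup_pd lookup_add distrib_left)

lemma pd_Const: "pd j (Const c) = 0"
proof (rule poly_mapping_eqI)
  fix m
  have "m + e j \<noteq> 0"
    using lookup_add[of m "e j" j] by auto
  then show "Poly_Mapping.lookup (pd j (Const c)) m = Poly_Mapping.lookup 0 m"
    by (simp add: lookup_pd lookup_single when_def)
qed

lemma pd_T_mult: "pd j (T l * f) = (if j = l then f else 0) + T l * pd j f"
proof (rule poly_mapping_eqI)
  fix m :: "nat \<Rightarrow>\<^sub>0 nat"
  let ?m = "Poly_Mapping.lookup m"
  show "Poly_Mapping.lookup (pd j (T l * f)) m =
      Poly_Mapping.lookup ((if j = l then f else 0) + T l * pd j f) m"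
  proof (cases "?m l = 0")
    case False
    have "m + e j - e l = m - e l + e j"
      using False by (intro poly_mapping_eqI) (auto simp: lookup_add lookup_minus lookup_single when_def)
    then show ?thesis
      using False add_diff_e[OF False]
      by (auto simp: lookup_pd lookup_add lookup_T_mult lookup_minus lookup_single when_def distrib_right left_diff_distrib)
  qed (auto simp: lookup_pd lookup_add lookup_T_mult lookup_single when_def)
qed

interpretation pd: ring_derivation "pd j :: 'k::field_char_0 dpoly \<Rightarrow> 'k dpoly" for j
proof
  show "pd j (f + g) = pd j f + pd j g" for f g :: "'k dpoly"
    by (rule pd_add)
  have pd_0: "pd j (0 :: 'k dpoly) = 0" using pd_add[of j 0 0] by simp
  have Const_mult: "pd j (Const c * g) = Const c * pd j g" for c and g :: "'k dpoly"
    by (rule poly_mapping_eqI) (simp only: lookup_pd lookup_Const_mult mult.left_commute)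
  show "pd j (f * g) = pd j f * g + f * pd j g" for f g :: "'k dpoly"
  proof (induction f rule: dpoly_induct)
    case (single m c)
    show ?case
    proof (induction m c rule: single_monom_induct)
      case (Const c)
      show ?case by (simp add: pd_Const Const_mult)
    next
      case (mult f l)
      then show ?case by (simp add: mult.assoc pd_T_mult distrib_left distrib_right add.assoc)
    qed
  qed (simp_all add: pd_0 pd_add algebra_simps)
qed

lemma pd_T: "pd j (T l) = (if j = l then 1 else 0)"
  using pd_T_mult[of j l 1] by simp

text \<open>The pairing is the constant term of the action of \<open>f\<close> on \<open>g\<close> by \<open>T\<^sub>j \<mapsto> j! \<partial>/\<partial>T\<^sub>j\<close>.\<close>

definition pairing :: "'k::field_char_0 dpoly \<Rightarrow> 'k dpoly \<Rightarrow> 'k" where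
  "pairing f g = (\<Sum>m\<in>Poly_Mapping.keys f.
     Poly_Mapping.lookup f m * monom_fact m * Poly_Mapping.lookup g m)"

lemma pairing_superset:
  assumes "finite S" "Poly_Mapping.keys f \<subseteq> S"
  shows "pairing f g =
    (\<Sum>m\<in>S. Poly_Mapping.lookup f m * monom_fact m * Poly_Mapping.lookup g m)"
  unfolding pairing_def
  by (rule sum.mono_neutral_left) (use assms in \<open>auto simp: in_keys_iff\<close>)

lemma pairing_add_left: "pairing (f + g) h = pairing f h + pairing g h"
proof -
  let ?S = "Poly_Mapping.keys f \<union> Poly_Mapping.keys g"
  have "Poly_Mapping.keys (f + g) \<subseteq> ?S" by (rule keys_add)
  then show ?thesis
    by (simp add: pairing_superset[of ?S] lookup_add distrib_right sum.distrib)
qed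

lemma pairing_0_left [simp]: "pairing 0 g = 0"
  by (simp add: pairing_def)

lemma pairing_0_right [simp]: "pairing f 0 = 0"
  by (simp add: pairing_def)

lemma pairing_sum_left: "pairing (sum f A) g = (\<Sum>x\<in>A. pairing (f x) g)"
  by (induction A rule: infinite_finite_induct) (simp_all add: pairing_add_left)

lemma pairing_sum_right: "pairing f (sum g A) = (\<Sum>x\<in>A. pairing f (g x))"
  unfolding pairing_def lookup_sum sum_distrib_left by (rule sum.swap)

lemma pairing_of_nat_left: "pairing (of_nat c * f) g = of_nat c * pairing f g"
  by (induction c) (simp_all add: distrib_right pairing_add_left)

lemma pairing_single:
  "pairing (Poly_Mapping.single m a) g = a * monom_fact m * Poly_Mapping.lookup g m"
  by (subst pairing_superset[of "{m}"]) auto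

text \<open>Multiplication by \<open>T j\<close> is adjoint to \<open>j!\<close> times the partial
  derivative; on monomials this is the recursion \<open>monom_fact_add_e\<close>.\<close>

lemma pairing_T_mult: "pairing (T j * f) g = fact j * pairing f (pd j g)"
proof (induction f rule: dpoly_induct)
  case (single m a)
  show ?case
    by (simp add: T_mult_single pairing_single lookup_pd monom_fact_add_e ac_simps)
qed (simp_all add: distrib_left pairing_add_left)

lemma pairing_T_power_mult:
  "pairing (T j ^ n * f) g = fact j ^ n * pairing f ((pd j ^^ n) g)"
  by (induction n arbitrary: g) (simp_all add: mult.assoc pairing_T_mult funpow_swap1)

text \<open>The operator \<open>\<Sum>k. X^k * pd k\<close>, acting on power series with
  \<open>X\<close> treated as a constant.\<close>

definition fps_pd :: "'k::field_char_0 dpoly fps \<Rightarrow> 'k dpoly fps" where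
  "fps_pd f = Abs_fps (\<lambda>n. \<Sum>k\<le>n. pd k (fps_nth f (n - k)))"

lemma fps_pd_nth: "fps_nth (fps_pd f) n = (\<Sum>k\<le>n. pd k (fps_nth f (n - k)))"
  by (simp add: fps_pd_def)

interpretation fps_pd: ring_derivation "fps_pd :: 'k::field_char_0 dpoly fps \<Rightarrow> 'k dpoly fps"
proof
  show "fps_pd (f + g) = fps_pd f + fps_pd g" for f g :: "'k dpoly fps"
    by (rule fps_ext) (simp add: fps_pd_nth pd.D_add sum.distrib)
  have *: "fps_nth (fps_pd f * g) n =
      (\<Sum>k\<le>n. \<Sum>i\<le>n - k. pd k (fps_nth f i) * fps_nth g (n - k - i))"
    for f g :: "'k dpoly fps" and n
    using fps_mult_assoc_lemma[of "\<lambda>k i l. pd k (fps_nth f i) * fps_nth g l" n n]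
    by (simp add: fps_mult_nth fps_pd_nth sum_distrib_right atLeast0AtMost)
  have "fps_nth (fps_pd (f * g)) n = fps_nth (fps_pd f * g) n + fps_nth (fps_pd g * f) n"
    for f g :: "'k dpoly fps" and n
  proof -
    \<comment> \<open>Reversing the convolution gives the second half of the product rule the shape
      of the first, with \<open>f\<close> and \<open>g\<close> exchanged.\<close>
    have rev: "(\<Sum>i\<le>l. fps_nth f i * pd k (fps_nth g (l - i))) =
        (\<Sum>i\<le>l. pd k (fps_nth g i) * fps_nth f (l - i))" for k l
      by (rule sum.reindex_bij_witness[of _ "\<lambda>i. l - i" "\<lambda>i. l - i"]) (auto simp: mult.commute)
    have "fps_nth (fps_pd (f * g)) n =
        (\<Sum>k\<le>n. (\<Sum>i\<le>n - k. pd k (fps_nth f i) * fps_nth g (n - k - i)) +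
          (\<Sum>i\<le>n - k. fps_nth f i * pd k (fps_nth g (n - k - i))))"
      by (simp add: fps_pd_nth fps_mult_nth pd.D_sum pd.D_mult sum.distrib atLeast0AtMost)
    then show ?thesis unfolding rev by (simp add: * sum.distrib)
  qed
  then show "fps_pd (f * g) = fps_pd f * g + f * fps_pd g" for f g :: "'k dpoly fps"
    by (intro fps_ext) (simp add: mult.commute)
qed

text \<open>
  The pairing turns multiplication by \<open>\<partial>\<^sup>n(T\<^sub>0\<^sup>p)\<close> into (\<open>n!\<close> times) the coefficient of \<open>X\<^sup>n\<close> in
  the \<open>p\<close>-th power of the operator \<open>\<Sum>\<^sub>k X\<^sup>k \<partial>/\<partial>T\<^sub>k\<close>.
\<close>

lemma pairing_funpow_deriv_T0_power_mult:
  "pairing ((deriv ^^ n) (T 0 ^ p) * f) g =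
     fact n * pairing f (fps_nth ((fps_pd ^^ p) (fps_const g)) n)"
proof (induction p arbitrary: n f)
  case 0
  have "(deriv ^^ n) (T 0 ^ 0 :: 'a dpoly) = (if n = 0 then 1 else 0)"
    by (cases n) (simp_all add: funpow_swap1)
  then show ?case by (simp add: pairing_def)
next
  case (Suc p)
  let ?c = "\<lambda>n. fps_nth ((fps_pd ^^ p) (fps_const g)) n"
  have "pairing ((deriv ^^ n) (T 0 ^ Suc p) * f) g =
      (\<Sum>k\<le>n. of_nat (n choose k) * pairing ((deriv ^^ (n - k)) (T 0 ^ p) * (T k * f)) g)"
    unfolding funpow_deriv_T0_power_Suc
    by (simp add: sum_distrib_right pairing_sum_left pairing_of_nat_left mult.assoc)
       (simp add: mult.left_commute)
  \<comment> \<open>The adjoint of \<open>T k\<close> supplies \<open>k!\<close> and the induction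
    hypothesis \<open>(n - k)!\<close>; with the binomial they give \<open>n!\<close>.\<close>
  also have "\<dots> = (\<Sum>k\<le>n. fact n * pairing f (pd k (?c (n - k))))"
    by (rule sum.cong) (simp_all add: Suc pairing_T_mult binomial_fact)
  finally show ?case by (simp add: fps_pd_nth pairing_sum_right sum_distrib_left)
qed

section \<open>The Hankel determinant and its derivatives\<close>

definition hankel_det :: "nat \<Rightarrow> 'k::field_char_0 dpoly" where
  "hankel_det i = (\<Sum>\<sigma> | \<sigma> permutes {..i}. of_int (sign \<sigma>) * (\<Prod>r\<in>{..i}. T (r + \<sigma> r)))"

lemma fps_const_prod: "fps_const (prod f A) = (\<Prod>x\<in>A. fps_const (f x :: 'a::comm_ring_1))"
  by (induction A rule: infinite_finite_induct) (simp_all flip: fps_const_mult)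

lemma fps_const_sum: "fps_const (sum f A) = (\<Sum>x\<in>A. fps_const (f x :: 'a::comm_ring_1))"
  by (induction A rule: infinite_finite_induct) (simp_all flip: fps_const_add)

text \<open>The entry \<open>T (r + s)\<close> is sent to \<open>X^(r + s) = X^r * X^s\<close>, a
  rank-one matrix with entries killed by \<open>fps_pd\<close>.\<close>

lemma fps_pd_hankel_det: "fps_pd (fps_pd (fps_const (hankel_det i :: 'k::field_char_0 dpoly))) = 0"
proof -
  have "fps_const (hankel_det i :: 'k dpoly) =
      (\<Sum>\<sigma> | \<sigma> permutes {..i}. of_int (sign \<sigma>) * (\<Prod>r\<in>{..i}. fps_const (T (r + \<sigma> r))))"
    by (simp add: hankel_det_def fps_const_sum fps_const_prod fps_of_int flip: fps_const_mult)
  moreover have "fps_pd (fps_pd \<dots>) = 0"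
  proof (rule fps_pd.D_D_det_rank_one[where v = "\<lambda>r. fps_X ^ r"])
    show "x = 0" if "x + x = 0" for x :: "'k dpoly fps"
    proof (intro fps_ext poly_mapping_eqI)
      fix n m
      have "Poly_Mapping.lookup (fps_nth (x + x) n) m = 0" unfolding that by simp
      then have "Poly_Mapping.lookup (fps_nth x n) m + Poly_Mapping.lookup (fps_nth x n) m = 0"
        by (simp only: fps_add_nth lookup_add)
      then show "Poly_Mapping.lookup (fps_nth x n) m = Poly_Mapping.lookup (fps_nth 0 n) m"
        by simp
    qed
    show "fps_pd (fps_const (T (r + s))) = fps_X ^ r * (fps_X ^ s :: 'k dpoly fps)" for r s
    proof (rule fps_ext)
      fix n
      have "fps_nth (fps_pd (fps_const (T (r + s)))) n =
          (\<Sum>k\<le>n. if k = n then pd n (T (r + s) :: 'k dpoly) else 0)"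
        unfolding fps_pd_nth by (rule sum.cong) auto
      also have "\<dots> = fps_nth (fps_X ^ (r + s)) n"
        by (simp add: pd_T fps_X_power_nth)
      finally show "fps_nth (fps_pd (fps_const (T (r + s)))) n =
          fps_nth (fps_X ^ r * (fps_X ^ s :: 'k dpoly fps)) n"
        by (simp only: power_add)
    qed
    show "fps_pd (fps_X ^ r :: 'k dpoly fps) = 0" for r
      by (rule fps_ext) (simp add: fps_pd_nth fps_X_power_nth if_distrib[of "pd _"] cong: if_cong)
  qed simp
  ultimately show ?thesis by simp
qed

text \<open>Each term is a product of \<open>i + 1\<close> variables, so at order
  \<open>i + 1\<close> only the term \<open>T i ^ Suc i\<close> survives. It belongs to the
  order-reversing permutation alone, whence the constant is plus or minus
  \<open>(i + 1)!\<close>.\<close>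

lemma pd_hankel_det_top:
  "(pd i ^^ Suc (Suc i)) (hankel_det i :: 'k::field_char_0 dpoly) = 0"
  "\<exists>c. c \<noteq> 0 \<and> (pd i ^^ Suc i) (hankel_det i :: 'k::field_char_0 dpoly) = of_int c"
proof -
  let ?\<tau> = "\<lambda>r. if r \<le> i then i - r else r"
  let ?P = "\<lambda>\<sigma>. \<Prod>r\<in>{..i}. T (r + \<sigma> r) :: 'k dpoly"
  have P: "(pd i ^^ Suc (Suc i)) (?P \<sigma>) = 0"
    "(pd i ^^ Suc i) (?P \<sigma>) = of_nat (fact (Suc i)) * (\<Prod>r\<in>{..i}. pd i (T (r + \<sigma> r)))" for \<sigma>
  proof -
    have "pd i (pd i (T (r + \<sigma> r) :: 'k dpoly)) = 0" for r by (simp add: pd_T)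
    then show "(pd i ^^ Suc (Suc i)) (?P \<sigma>) = 0"
      "(pd i ^^ Suc i) (?P \<sigma>) = of_nat (fact (Suc i)) * (\<Prod>r\<in>{..i}. pd i (T (r + \<sigma> r)))"
      using pd.funpow_D_prod_top[of "{..i}" i "\<lambda>r. T (r + \<sigma> r) :: 'k dpoly"]
      by (simp_all del: funpow.simps fact_Suc)
  qed
  show "(pd i ^^ Suc (Suc i)) (hankel_det i :: 'k dpoly) = 0"
    unfolding hankel_det_def pd.funpow_D_sum pd.funpow_D_of_int_mult P by simp
  have \<tau>: "?\<tau> permutes {..i}"
    by (rule bij_imp_permutes, rule bij_betw_byWitness[of _ ?\<tau>]) auto
  have "(\<Prod>r\<in>{..i}. pd i (T (r + \<sigma> r)) :: 'k dpoly) = (if \<sigma> = ?\<tau> then 1 else 0)"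
    if "\<sigma> permutes {..i}" for \<sigma>
  proof (cases "\<forall>r\<in>{..i}. i = r + \<sigma> r")
    case True
    have "\<sigma> r = ?\<tau> r" for r
    proof (cases "r \<le> i")
      case le: True
      then have "i = r + \<sigma> r" using True by blast
      then have "\<sigma> r = i - r" by linarith
      then show ?thesis using le by simp
    next
      case False
      then show ?thesis using permutes_not_in[OF that, of r] by simp
    qed
    then have "\<sigma> = ?\<tau>" by blast
    then show ?thesis using True by (simp add: pd_T)
  next
    case False
    then have "\<sigma> \<noteq> ?\<tau>" by auto
    then show ?thesis using False by (auto simp: pd_T)
  qed
  then have "(pd i ^^ Suc i) (hankel_det i :: 'k dpoly) =
      (\<Sum>\<sigma> | \<sigma> permutes {..i}. if \<sigma> = ?\<tau> then of_int (sign \<sigma>) * of_nat (fact (Suc i)) else 0)"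
    unfolding hankel_det_def pd.funpow_D_sum pd.funpow_D_of_int_mult P
    by (intro sum.cong) simp_all
  also have "\<dots> = of_int (sign ?\<tau> * fact (Suc i))"
    using \<tau> by (subst sum.delta) (simp_all add: finite_permutations algebra_simps)
  finally show "\<exists>c. c \<noteq> 0 \<and> (pd i ^^ Suc i) (hankel_det i :: 'k dpoly) = of_int c"
    by (intro exI[of _ "sign ?\<tau> * fact (Suc i)"]) (simp add: sign_def)
qed

lemma pairing_ideal_gen_hankel_det:
  assumes "x \<in> diff_ideal_gen (T 0 ^ Suc d)"
  shows "pairing x (hankel_det i ^ d :: 'k::field_char_0 dpoly) = 0"
proof -
  \<comment> \<open>Quantifying over all multiples makes this an ideal, which the kernel of the
    pairing itself need not be.\<close>
  let ?N = "{x. \<forall>f. pairing (f * x) (hankel_det i ^ d :: 'k dpoly) = 0}"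
  have "fps_const (hankel_det i ^ d :: 'k dpoly) = fps_const (hankel_det i) ^ d"
    by (simp add: fps_const_power)
  \<comment> \<open>Two applications kill the determinant, so \<open>1 * d + 1\<close> applications
    kill its \<open>d\<close>-th power; this matches the exponent in
    \<open>T 0 ^ Suc d\<close>.\<close>
  then have "(fps_pd ^^ Suc d) (fps_const (hankel_det i ^ d :: 'k dpoly)) = 0"
    using fps_pd.funpow_D_power_top[of 1 "fps_const (hankel_det i :: 'k dpoly)" d]
    by (simp add: fps_pd_hankel_det)
  then have "pairing (f * (deriv ^^ n) (T 0 ^ Suc d)) (hankel_det i ^ d :: 'k dpoly) = 0" for f n
    unfolding mult.commute[of f] pairing_funpow_deriv_T0_power_mult by (simp del: funpow.simps)
  then have "(deriv ^^ n) (T 0 ^ Suc d) \<in> ?N" for n by blast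
  moreover have "module.subspace (*) ?N"
    unfolding ideal_iff by (auto simp: distrib_left pairing_add_left simp flip: mult.assoc)
  ultimately have "diff_ideal_gen (T 0 ^ Suc d) \<subseteq> ?N"
    unfolding diff_ideal_gen_eq_span by (intro module.span_minimal[OF module_self]) blast
  then have "x \<in> ?N" using assms by blast
  then have "pairing (1 * x) (hankel_det i ^ d) = 0" by blast
  then show ?thesis by simp
qed

text \<open>Membership would make the pairing with \<open>hankel_det i ^ d\<close> vanish, but up to
  a power of \<open>i!\<close> that pairing is the top derivative in \<open>T i\<close>, a nonzero
  integer constant.\<close>

lemma T_power_notin_ideal_gen:
  "(T i :: 'k::field_char_0 dpoly) ^ (Suc i * d) \<notin> diff_ideal_gen (T 0 ^ Suc d)"
proof
  assume "(T i :: 'k dpoly) ^ (Suc i * d) \<in> diff_ideal_gen (T 0 ^ Suc d)"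
  then have "pairing (T i ^ (Suc i * d) * 1) (hankel_det i ^ d :: 'k dpoly) = 0"
    using pairing_ideal_gen_hankel_det by simp
  then have 0: "pairing 1 ((pd i ^^ (Suc i * d)) (hankel_det i ^ d) :: 'k dpoly) = 0"
    unfolding pairing_T_power_mult by simp
  obtain c where c: "c \<noteq> 0" "(pd i ^^ Suc i) (hankel_det i :: 'k dpoly) = of_int c"
    using pd_hankel_det_top(2) by blast
  obtain b where b: "b > 0"
    "(pd i ^^ (Suc i * d)) (hankel_det i ^ d) = of_nat b * ((pd i ^^ Suc i) (hankel_det i) :: 'k dpoly) ^ d"
    using pd.funpow_D_power_top[OF pd_hankel_det_top(1)] by blast
  have "(pd i ^^ (Suc i * d)) (hankel_det i ^ d) = (of_int (int b * c ^ d) :: 'k dpoly)"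
    unfolding b c by simp
  moreover have "pairing 1 (of_int z :: 'k dpoly) = of_int z" for z
    using pairing_single[of 0 1 "of_int z :: 'k dpoly"] by (simp add: lookup_of_int)
  ultimately have "(of_int (int b * c ^ d) :: 'k) = 0" using 0 by metis
  then show False using b(1) c(1) by (simp only: of_int_eq_0_iff) simp
qed

theorem mainTheorem1:
  fixes p i :: nat
  assumes "p \<ge> 1"
  shows "(\<exists>q>0. (T i :: 'k::field_char_0 dpoly) ^ q \<in> diff_ideal_gen (T 0 ^ p)) \<and>
    (LEAST q. q > 0 \<and> (T i :: 'k dpoly) ^ q \<in> diff_ideal_gen (T 0 ^ p)) = (i + 1) * p - i"
proof -
  obtain d where p: "p = Suc d" using assms by (cases p) auto
  let ?q = "Suc i * d + 1"
  have q: "(i + 1) * p - i = ?q" by (simp add: p)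
  have mem: "(T i :: 'k dpoly) ^ ?q \<in> diff_ideal_gen (T 0 ^ p)"
    unfolding p by (rule T_power_in_ideal_gen)
  have "?q \<le> q" if "(T i :: 'k dpoly) ^ q \<in> diff_ideal_gen (T 0 ^ p)" for q
  proof (rule ccontr)
    assume "\<not> ?q \<le> q"
    \<comment> \<open>A smaller exponent in the ideal would, by multiplication, put the excluded
      power \<open>Suc i * d\<close> there too.\<close>
    then have "(T i :: 'k dpoly) ^ (Suc i * d) = T i ^ (Suc i * d - q) * T i ^ q"
      by (simp flip: power_add)
    then show False
      using ideal_gen(3)[OF that] T_power_notin_ideal_gen[of i d, where 'k = 'k] unfolding p by metis
  qed
  then have "(LEAST q. q > 0 \<and> (T i :: 'k dpoly) ^ q \<in> diff_ideal_gen (T 0 ^ p)) = ?q"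
    using mem by (intro Least_equality) auto
  then show ?thesis using mem unfolding q by (intro conjI exI[of _ ?q]) auto
qed

end
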